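(* Let $k\ge 1$ be an integer. The average-case objective privacy-approximation ratio, with respect to the uniform distribution on $\{0,\ldots,2^k-1\}^2$, of the Bisection Auction for the two-bidder $2^{nd}$-price auction on $k$-bit inputs equals $\frac{k}{2}+1$.
   Context: Communication model. Bidders $1$ and $2$ hold private inputs $x_1,x_2\in\{0,\ldots,2^k-1\}$ respectively. In a deterministic protocol $P$ the parties exchange (announce) bits; the identity of the next sender is determined by the history of bits sent so far, and each bit is a function of the sender's own input and the history. The sequence of all bits sent on input $(x_1,x_2)$ is the transcript. $P$ is a protocol for a function $f$ if the transcript determines $f(x_1,x_2)$. For an input $(x_1,x_2)$ let $R^P(x_1,x_2)$ be the set of all inputs having the same transcript as $(x_1,x_2)$; it is a combinatorial rectangle on which $f$ is constant. Let $R^I(x_1,x_2)=\{(x_1',x_2'): f(x_1',x_2')=f(x_1,x_2)\}$. The average-case objective privacy-approximation ratio (PAR) of $P$ under a distribution $D$ on inputs is $E_D\big[|R^I(x_1,x_2)|/|R^P(x_1,x_2)|\big]$. $2^{nd}$-price auction: $f(x_1,x_2)=(1,x_2)$ if $x_1\ge x_2$ and $f(x_1,x_2)=(2,x_1)$ if $x_1<x_2$ (identity of the higher bidder, ties in favor of bidder $1$, and the value of the other bidder). Bisection Auction: start with the interval $[0,2^k)$. At each step, with current interval $[a,a+2^m)$, $m\ge1$, containing both values, each of the two bidders announces whether its value lies in the lower half or the upper half of the interval. If the answers agree, continue with the common half; if this goes on until the interval has one element, the values are equal and the item goes to bidder $1$ at the common value. If the answers differ, the bidder in the upper half wins, and the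 exact value of the other bidder is then found by binary search on the lower half, with only the losing bidder answering. *)

theory Defs
  imports "HOL-Probability.Probability"
begin

datatype bidder = Bidder1 | Bidder2

fun value_of :: "bidder \<Rightarrow> 'a \<times> 'a \<Rightarrow> 'a" where
  "value_of Bidder1 x = fst x"
| "value_of Bidder2 x = snd x"

text \<open>
  A deterministic protocol is represented by its protocol tree: a node is a history of bits, and it
  records who sends next together with the bit sent as a function of the sender's own input. The
  two subtrees are the continuations after the bit False and after the bit True, in this order.
\<close>

datatype 'a protocol =
    Stop
  | Send bidder "'a \<Rightarrow> bool" "'a protocol" "'a protocol"

fun transcript :: "'a protocol \<Rightarrow> 'a \<times> 'a \<Rightarrow> bool list" where
  "transcript Stop x = []"
| "transcript (Send i msg P0 P1) x =
     (if msg (value_of i x) then True # transcript P1 x else False # transcript P0 x)"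

text \<open>The set of all possible inputs is an explicit parameter \<open>X\<close> of the following notions.\<close>

definition protocol_for ::
  "('a \<times> 'a) set \<Rightarrow> 'a protocol \<Rightarrow> ('a \<times> 'a \<Rightarrow> 'b) \<Rightarrow> bool" where
  "protocol_for X P f \<longleftrightarrow> (\<exists>g. \<forall>x\<in>X. f x = g (transcript P x))"

definition protocol_region ::
  "('a \<times> 'a) set \<Rightarrow> 'a protocol \<Rightarrow> 'a \<times> 'a \<Rightarrow> ('a \<times> 'a) set" where
  "protocol_region X P x = {y \<in> X. transcript P y = transcript P x}"

definition ideal_region ::
  "('a \<times> 'a) set \<Rightarrow> ('a \<times> 'a \<Rightarrow> 'b) \<Rightarrow> 'a \<times> 'a \<Rightarrow> ('a \<times> 'a) set" where
  "ideal_region X f x = {y \<in> X. f y = f x}"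

text \<open>Meaningful when \<open>X\<close> is finite, \<open>P\<close> is a protocol for \<open>f\<close> on \<open>X\<close>, and \<open>D\<close> is supported on \<open>X\<close>.\<close>

definition average_objective_PAR ::
  "('a \<times> 'a) set \<Rightarrow> 'a protocol \<Rightarrow> ('a \<times> 'a \<Rightarrow> 'b) \<Rightarrow> ('a \<times> 'a) pmf \<Rightarrow> real" where
  "average_objective_PAR X P f D =
     measure_pmf.expectation D
       (\<lambda>x. real (card (ideal_region X f x)) / real (card (protocol_region X P x)))"

definition auction_inputs :: "nat \<Rightarrow> (nat \<times> nat) set" where
  "auction_inputs k = {0..<2 ^ k} \<times> {0..<2 ^ k}"

definition second_price_auction :: "nat \<times> nat \<Rightarrow> bidder \<times> nat" where
  "second_price_auction = (\<lambda>(x1, x2). if x1 \<ge> x2 then (Bidder1, x2) else (Bidder2, x1))"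

text \<open>
  In the two protocols below, the current interval is \<open>{a..<a + 2 ^ m}\<close>, and the bit True announces
  that the sender's value lies in the upper half. The two announcements of a bisection step are sent
  one after the other, bidder 1 first; the bit of bidder 2 does not depend on that of bidder 1.
\<close>

fun binary_search :: "bidder \<Rightarrow> nat \<Rightarrow> nat \<Rightarrow> nat protocol" where
  "binary_search i a 0 = Stop"
| "binary_search i a (Suc m) =
     Send i (\<lambda>v. a + 2 ^ m \<le> v) (binary_search i a m) (binary_search i (a + 2 ^ m) m)"

fun bisection :: "nat \<Rightarrow> nat \<Rightarrow> nat protocol" where
  "bisection a 0 = Stop"
| "bisection a (Suc m) =
     Send Bidder1 (\<lambda>v. a + 2 ^ m \<le> v)
       (Send Bidder2 (\<lambda>v. a + 2 ^ m \<le> v) (bisection a m) (binary_search Bidder1 a m))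
       (Send Bidder2 (\<lambda>v. a + 2 ^ m \<le> v) (binary_search Bidder2 a m) (bisection (a + 2 ^ m) m))"

definition bisection_auction :: "nat \<Rightarrow> nat protocol" where
  "bisection_auction k = bisection 0 k"

lemma transcript_binary_search_determines:
  assumes "transcript (binary_search i a m) x = transcript (binary_search i a m) y"
    and "value_of i x \<in> {a..<a + 2 ^ m}" and "value_of i y \<in> {a..<a + 2 ^ m}"
  shows "value_of i x = value_of i y"
  using assms by (induction m arbitrary: a) (auto split: if_splits)

lemma transcript_bisection_determines:
  assumes "transcript (bisection a m) x = transcript (bisection a m) y"
    and "x \<in> {a..<a + 2 ^ m} \<times> {a..<a + 2 ^ m}" and "y \<in> {a..<a + 2 ^ m} \<times> {a..<a + 2 ^ m}"
  shows "second_price_auction x = second_price_auction y"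
  using assms
proof (induction m arbitrary: a)
  case 0
  then show ?case by (auto simp: second_price_auction_def)
next
  case (Suc m)
  note s1 = transcript_binary_search_determines[of Bidder1 a m x y]
  note s2 = transcript_binary_search_determines[of Bidder2 a m x y]
  show ?case
    using Suc.prems Suc.IH[of a] Suc.IH[of "a + 2 ^ m"] s1 s2
    by (cases x; cases y) (auto simp: second_price_auction_def split: if_splits)
qed

lemma bisection_auction_protocol_for:
  "protocol_for (auction_inputs k) (bisection_auction k) second_price_auction"
proof -
  define g where "g t = second_price_auction
    (SOME y. y \<in> auction_inputs k \<and> transcript (bisection_auction k) y = t)" for t
  have "second_price_auction x = g (transcript (bisection_auction k) x)"
    if x: "x \<in> auction_inputs k" for x
  proof -
    let ?P = "\<lambda>y. y \<in> auction_inputs k \<and>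
      transcript (bisection_auction k) y = transcript (bisection_auction k) x"
    have "?P (SOME y. ?P y)" by (rule someI[of ?P x]) (use x in simp)
    then show ?thesis
      unfolding g_def using x transcript_bisection_determines[of 0 k x "SOME y. ?P y"]
      by (simp add: auction_inputs_def bisection_auction_def)
  qed
  then show ?thesis unfolding protocol_for_def by blast
qed

end

theory Submission
  imports Defs
begin

text \<open>
  Announcing one bit splits the inputs into the two parts on which the bit is constant, and the sum of
  \<open>|R\<^sup>I(x)| / |R\<^sup>P(x)|\<close> over all inputs is additive over these parts. A bisection step therefore
  splits the square over \<open>[a, a + 2\<^sup>m\<^sup>+\<^sup>1)\<close> into two diagonal squares, which are treated recursively,
  and two off-diagonal squares. In the latter each transcript class fixes exactly the value of the
  loser, so the sum is that of \<open>|R\<^sup>I|\<close> over the lower half, namely of \<open>N - v\<close> when bidder 1 wins and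
  of \<open>N - 1 - v\<close> when bidder 2 wins, where \<open>N = 2\<^sup>k\<close>. With \<open>b = N - a\<close> the two together contribute
  \<open>2 b 2\<^sup>m - 4\<^sup>m\<close>, and the recursion is solved by \<open>2\<^sup>m (m + 1) b - 4\<^sup>m m / 2\<close>.
\<close>

text \<open>The weight is separate from \<open>X\<close> because the recursion shrinks
  \<open>X\<close> to subsquares: the transcript classes shrink with it, whereas the ideal regions
  stay those of the full input set.\<close>

definition weighted_region_sum ::
  "('a \<times> 'a \<Rightarrow> real) \<Rightarrow> ('a \<times> 'a) set \<Rightarrow> 'a protocol \<Rightarrow> real" where
  "weighted_region_sum w X P = (\<Sum>x\<in>X. w x / real (card (protocol_region X P x)))"

lemma weighted_region_sum_cong:
  assumes "\<And>x. x \<in> X \<Longrightarrow> w x = w' x"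
  shows "weighted_region_sum w X P = weighted_region_sum w' X P"
  unfolding weighted_region_sum_def by (intro sum.cong) (auto simp: assms)

text \<open>Inputs with different first bits never share a transcript, so the class of an input lies
  inside its own part and is the class that the remaining subtree induces there.\<close>

lemma weighted_region_sum_Send:
  assumes "finite X"
  shows "weighted_region_sum w X (Send i msg P0 P1) =
    weighted_region_sum w {x\<in>X. \<not> msg (value_of i x)} P0 +
    weighted_region_sum w {x\<in>X. msg (value_of i x)} P1"
proof -
  let ?X0 = "{x\<in>X. \<not> msg (value_of i x)}" and ?X1 = "{x\<in>X. msg (value_of i x)}"
  let ?h = "\<lambda>x. w x / real (card (protocol_region X (Send i msg P0 P1) x))"
  have "protocol_region X (Send i msg P0 P1) x = protocol_region ?X0 P0 x" if "x \<in> ?X0" for x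
    using that by (auto simp: protocol_region_def split: if_splits)
  then have s0: "sum ?h ?X0 = weighted_region_sum w ?X0 P0"
    unfolding weighted_region_sum_def by (intro sum.cong) auto
  have "protocol_region X (Send i msg P0 P1) x = protocol_region ?X1 P1 x" if "x \<in> ?X1" for x
    using that by (auto simp: protocol_region_def split: if_splits)
  then have s1: "sum ?h ?X1 = weighted_region_sum w ?X1 P1"
    unfolding weighted_region_sum_def by (intro sum.cong) auto
  have "sum ?h X = sum ?h (?X0 \<union> ?X1)"
    by (intro sum.cong) auto
  also have "\<dots> = sum ?h ?X0 + sum ?h ?X1"
    using assms by (intro sum.union_disjoint) auto
  finally show ?thesis
    using s0 s1 by (simp add: weighted_region_sum_def)
qed

lemma transcript_binary_search_cong:
  assumes "value_of i x = value_of i y"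
  shows "transcript (binary_search i a m) x = transcript (binary_search i a m) y"
  using assms by (induction m arbitrary: a) auto

lemma transcript_binary_search_eq_iff:
  assumes "value_of i x \<in> {a..<a + 2 ^ m}" "value_of i y \<in> {a..<a + 2 ^ m}"
  shows "transcript (binary_search i a m) x = transcript (binary_search i a m) y \<longleftrightarrow>
    value_of i x = value_of i y"
  using assms transcript_binary_search_determines transcript_binary_search_cong by blast

text \<open>Binary search reveals exactly the sender's value, so each class is a strip
  \<open>{v} \<times> B\<close>; its \<open>card B\<close> inputs contribute
  \<open>g v / card B\<close> each.\<close>

lemma weighted_region_sum_binary_search_fst:
  fixes g :: "nat \<Rightarrow> real"
  assumes "finite B" "B \<noteq> {}"
  shows "weighted_region_sum (\<lambda>x. g (fst x)) ({a..<a + 2 ^ m} \<times> B) (binary_search Bidder1 a m) =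
    (\<Sum>v=a..<a + 2 ^ m. g v)"
proof -
  have "protocol_region ({a..<a + 2 ^ m} \<times> B) (binary_search Bidder1 a m) x = {fst x} \<times> B"
    if "x \<in> {a..<a + 2 ^ m} \<times> B" for x
    using that transcript_binary_search_eq_iff[of Bidder1 _ a m x]
    by (auto simp: protocol_region_def)
  then have "weighted_region_sum (\<lambda>x. g (fst x)) ({a..<a + 2 ^ m} \<times> B) (binary_search Bidder1 a m) =
    (\<Sum>x\<in>{a..<a + 2 ^ m} \<times> B. g (fst x) / real (card B))"
    unfolding weighted_region_sum_def by (intro sum.cong) (auto simp: card_cartesian_product)
  also have "\<dots> = (\<Sum>v=a..<a + 2 ^ m. \<Sum>u\<in>B. g v / real (card B))"
    unfolding sum.cartesian_product case_prod_unfold ..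
  finally show ?thesis using assms by simp
qed

lemma weighted_region_sum_binary_search_snd:
  fixes g :: "nat \<Rightarrow> real"
  assumes "finite A" "A \<noteq> {}"
  shows "weighted_region_sum (\<lambda>x. g (snd x)) (A \<times> {a..<a + 2 ^ m}) (binary_search Bidder2 a m) =
    (\<Sum>v=a..<a + 2 ^ m. g v)"
proof -
  have "protocol_region (A \<times> {a..<a + 2 ^ m}) (binary_search Bidder2 a m) x = A \<times> {snd x}"
    if "x \<in> A \<times> {a..<a + 2 ^ m}" for x
    using that transcript_binary_search_eq_iff[of Bidder2 _ a m x]
    by (auto simp: protocol_region_def)
  then have "weighted_region_sum (\<lambda>x. g (snd x)) (A \<times> {a..<a + 2 ^ m}) (binary_search Bidder2 a m) =
    (\<Sum>x\<in>A \<times> {a..<a + 2 ^ m}. g (snd x) / real (card A))"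
    unfolding weighted_region_sum_def by (intro sum.cong) (auto simp: card_cartesian_product)
  also have "\<dots> = (\<Sum>u\<in>A. \<Sum>v=a..<a + 2 ^ m. g v / real (card A))"
    unfolding sum.cartesian_product case_prod_unfold ..
  also have "\<dots> = (\<Sum>v=a..<a + 2 ^ m. \<Sum>u\<in>A. g v / real (card A))"
    by (rule sum.swap)
  finally show ?thesis using assms by simp
qed

text \<open>Closed form of the size of the ideal region for \<open>N = 2 ^ k\<close>: it counts the
  possible values of the winner. The \<open>- 1\<close> comes from ties going to bidder 1, so that
  bidder 2 must be strictly higher.\<close>

definition second_price_weight :: "real \<Rightarrow> nat \<times> nat \<Rightarrow> real" where
  "second_price_weight N x =
     (if snd x \<le> fst x then N - real (snd x) else N - 1 - real (fst x))"

lemma card_ideal_region_second_price: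
  assumes "x \<in> auction_inputs k"
  shows "real (card (ideal_region (auction_inputs k) second_price_auction x)) =
    second_price_weight (2 ^ k) x"
proof (cases "snd x \<le> fst x")
  case True
  then have "ideal_region (auction_inputs k) second_price_auction x = {snd x..<2 ^ k} \<times> {snd x}"
    using assms
    by (auto simp: ideal_region_def auction_inputs_def second_price_auction_def split: if_splits)
  then show ?thesis
    using True assms
    by (auto simp: second_price_weight_def card_cartesian_product auction_inputs_def of_nat_diff)
next
  case False
  then have "ideal_region (auction_inputs k) second_price_auction x =
      {fst x} \<times> {Suc (fst x)..<2 ^ k}"
    using assms
    by (auto simp: ideal_region_def auction_inputs_def second_price_auction_def split: if_splits)
  then show ?thesis
    using False assms
    by (auto simp: second_price_weight_def card_cartesian_product auction_inputs_def of_nat_diff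
        Suc_le_eq)
qed

text \<open>The two summands add up to \<open>(N - v)^2 - (N - v - 1)^2\<close>, which telescopes.
  Used with \<open>n = 2 ^ m\<close> for the two off-diagonal squares.\<close>

lemma sum_second_price_weights:
  "(\<Sum>v=a..<a + n. N - real v) + (\<Sum>v=a..<a + n. N - 1 - real v) =
    2 * (N - real a) * real n - (real n)\<^sup>2"
  by (induction n) (auto simp: algebra_simps power2_eq_square)

text \<open>The left end \<open>a\<close> varies in the induction, since passing to the upper half
  lowers \<open>N - a\<close> by \<open>2 ^ m\<close> while \<open>N\<close> stays fixed.\<close>

lemma weighted_region_sum_bisection:
  "weighted_region_sum (second_price_weight N) ({a..<a + 2 ^ m} \<times> {a..<a + 2 ^ m}) (bisection a m) =
    2 ^ m * (real m + 1) * (N - real a) - 4 ^ m * real m / 2"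
proof (induction m arbitrary: a)
  case 0
  have "{a..<a + 2 ^ 0} \<times> {a..<a + 2 ^ 0} = {(a, a)}" by auto
  then show ?case
    by (simp add: weighted_region_sum_def protocol_region_def second_price_weight_def)
next
  case (Suc m)
  let ?L = "{a..<a + 2 ^ m}" and ?U = "{a + 2 ^ m..<a + 2 ^ m + 2 ^ m}"
  let ?X = "{a..<a + 2 ^ Suc m} \<times> {a..<a + 2 ^ Suc m}"
  let ?S = "weighted_region_sum (second_price_weight N)"
  let ?up = "\<lambda>v. a + 2 ^ m \<le> v"
  have parts:
    "{x \<in> {x \<in> ?X. \<not> ?up (fst x)}. \<not> ?up (snd x)} = ?L \<times> ?L"
    "{x \<in> {x \<in> ?X. \<not> ?up (fst x)}. ?up (snd x)} = ?L \<times> ?U"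
    "{x \<in> {x \<in> ?X. ?up (fst x)}. \<not> ?up (snd x)} = ?U \<times> ?L"
    "{x \<in> {x \<in> ?X. ?up (fst x)}. ?up (snd x)} = ?U \<times> ?U"
    by auto
  have "?S ?X (bisection a (Suc m)) =
      ?S (?L \<times> ?L) (bisection a m) + ?S (?L \<times> ?U) (binary_search Bidder1 a m) +
      (?S (?U \<times> ?L) (binary_search Bidder2 a m) + ?S (?U \<times> ?U) (bisection (a + 2 ^ m) m))"
    by (simp only: bisection.simps weighted_region_sum_Send finite_SigmaI finite_atLeastLessThan
        finite_Collect_conjI simp_thms value_of.simps Collect_mem_eq parts)
  \<comment> \<open>On an off-diagonal square the winner is fixed, so the weight depends on the
    loser's value alone, which is the one being searched.\<close>
  also have "?S (?L \<times> ?U) (binary_search Bidder1 a m) = (\<Sum>v\<in>?L. N - 1 - real v)"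
    by (subst weighted_region_sum_binary_search_fst[symmetric, where B = ?U])
      (auto intro!: weighted_region_sum_cong simp: second_price_weight_def)
  also have "?S (?U \<times> ?L) (binary_search Bidder2 a m) = (\<Sum>v\<in>?L. N - real v)"
    by (subst weighted_region_sum_binary_search_snd[symmetric, where A = ?U])
      (auto intro!: weighted_region_sum_cong simp: second_price_weight_def)
  also note Suc.IH[of a]
  also note Suc.IH[of "a + 2 ^ m"]
  finally have "?S ?X (bisection a (Suc m)) =
      2 ^ m * (real m + 1) * (N - real a) - 4 ^ m * real m / 2 +
      (2 ^ m * (real m + 1) * (N - (real a + 2 ^ m)) - 4 ^ m * real m / 2) +
      (2 * (N - real a) * 2 ^ m - (2 ^ m)\<^sup>2)"
    using sum_second_price_weights[where a = a and n = "2 ^ m" and N = N]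
    by (simp only: of_nat_add of_nat_power of_nat_numeral)
  \<comment> \<open>Makes the \<open>4 ^ m\<close> of the closed form comparable with the products
    of powers of 2 from the recursion.\<close>
  moreover have "(4::real) ^ m = 2 ^ m * 2 ^ m"
    by (simp flip: power_mult_distrib)
  ultimately show ?case
    by (simp only: power_Suc of_nat_Suc) (simp add: field_simps power2_eq_square)
qed

theorem theorem5p2:
  fixes k :: nat
  assumes "k \<ge> 1"
  shows "average_objective_PAR (auction_inputs k) (bisection_auction k) second_price_auction
           (pmf_of_set (auction_inputs k)) = real k / 2 + 1"
proof -
  let ?X = "auction_inputs k"
  have X: "finite ?X" "?X \<noteq> {}" and card_X: "real (card ?X) = 4 ^ k"
    by (auto simp: auction_inputs_def card_cartesian_product simp flip: power_mult_distrib)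
  have "average_objective_PAR ?X (bisection_auction k) second_price_auction (pmf_of_set ?X) =
      weighted_region_sum (\<lambda>x. real (card (ideal_region ?X second_price_auction x))) ?X
        (bisection_auction k) / 4 ^ k"
    using X by (simp add: average_objective_PAR_def integral_pmf_of_set card_X
        weighted_region_sum_def)
  also have "\<dots> = weighted_region_sum (second_price_weight (2 ^ k)) ?X (bisection_auction k) / 4 ^ k"
    by (simp add: card_ideal_region_second_price cong: weighted_region_sum_cong)
  also have "\<dots> = (2 ^ k * (real k + 1) * 2 ^ k - 4 ^ k * real k / 2) / 4 ^ k"
    using weighted_region_sum_bisection[of "2 ^ k" 0 k]
    by (simp add: auction_inputs_def bisection_auction_def)
  \<comment> \<open>Exposes the common factor \<open>4 ^ k\<close>; dividing it out leaves
    \<open>k + 1 - k / 2\<close>.\<close>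
  also have "2 ^ k * (real k + 1) * 2 ^ k = 4 ^ k * (real k + 1)"
    by (simp flip: power_mult_distrib)
  finally show ?thesis
    by (simp add: diff_divide_distrib)
qed

end
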